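(* Consider the following program on states $(x,y)\in\mathbb{Z}^2$. Initially $(x,y)$ is an arbitrary element of $\mathbb{Z}^2$ supplied by the user. While $x>0$, the simultaneous assignment $(x,y)=(x+y,\,y-1)$ is executed (the right-hand side uses the old values). Then every run of this program terminates, i.e., every computation of it is finite.
   Context: A program is a tuple $(S,I,R)$ where $S$ is a set of states, $I\subseteq S$ is the set of possible initial states, and $R\subseteq S\times S$ is the set of pairs $(s,t)$ such that $s$ satisfies the condition of the while loop and one iteration of the loop body takes $s$ to $t$. A computation (run) is a finite or infinite sequence of states $s_1,s_2,\ldots$ with $s_1\in I$, with $R(s_i,s_{i+1})$ for all consecutive terms, and such that if the sequence is finite with last state $s$ then there is no $t$ with $R(s,t)$. Here $S=I=\mathbb{Z}^2$. *)

theory Defs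
  imports Main
begin

record 's program =
  states :: "'s set"
  initial :: "'s set"
  step :: "('s \<times> 's) set"

definition wf_program :: "'s program \<Rightarrow> bool" where
  "wf_program P \<longleftrightarrow>
     initial P \<subseteq> states P \<and> step P \<subseteq> states P \<times> states P"

text \<open>Finite or infinite sequences of states, indexed from 0.\<close>

datatype 's state_seq = Finite_Seq "'s list" | Infinite_Seq "nat \<Rightarrow> 's"

fun is_computation :: "'s program \<Rightarrow> 's state_seq \<Rightarrow> bool" where
  "is_computation P (Finite_Seq ss) \<longleftrightarrow>
     ss \<noteq> [] \<and> set ss \<subseteq> states P \<and> hd ss \<in> initial P \<and>
     (\<forall>i. Suc i < length ss \<longrightarrow> (ss ! i, ss ! Suc i) \<in> step P) \<and>
     \<not> (\<exists>t. (last ss, t) \<in> step P)"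
| "is_computation P (Infinite_Seq s) \<longleftrightarrow>
     range s \<subseteq> states P \<and> s 0 \<in> initial P \<and>
     (\<forall>i. (s i, s (Suc i)) \<in> step P)"

definition terminating :: "'s program \<Rightarrow> bool" where
  "terminating P \<longleftrightarrow>
     (\<forall>c. is_computation P c \<longrightarrow> (\<exists>ss. c = Finite_Seq ss))"

definition countdown_program :: "(int \<times> int) program" where
  "countdown_program =
     \<lparr> states = UNIV, initial = UNIV,
       step = {((x, y), (x', y')) | x y x' y'. x > 0 \<and> (x', y') = (x + y, y - 1)} \<rparr>"

lemma wf_countdown_program: "wf_program countdown_program"
  by (simp add: wf_program_def countdown_program_def)

end

theory Submission
  imports Defs
begin

text \<open>In an infinite run, y after i steps is its initial value minus i, so it is eventually at
  most -1. Each later step lowers x by at least 1, so x fails the guard in the end;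
  \<open>no_infinite_countdown\<close> carries this.\<close>

text \<open>
  The variable y drops by one in every iteration, so from some iteration on it is negative.
  From then on x strictly decreases and hence cannot stay positive.
\<close>

lemma countdown_step_iff:
  "(s, t) \<in> step countdown_program \<longleftrightarrow>
     fst s > 0 \<and> fst t = fst s + snd s \<and> snd t = snd s - 1"
  by (cases s; cases t) (auto simp: countdown_program_def)

lemma no_infinite_countdown:
  assumes run: "\<And>i. (s i, s (Suc i)) \<in> step countdown_program"
  shows False
proof -
  have pos: "fst (s i) > 0"
    and x_Suc: "fst (s (Suc i)) = fst (s i) + snd (s i)"
    and y_Suc: "snd (s (Suc i)) = snd (s i) - 1" for i
    using run[of i] by (simp_all add: countdown_step_iff)
  have y_eq: "snd (s i) = snd (s 0) - int i" for i
    by (induction i) (simp_all add: y_Suc)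
  \<comment> \<open>The \<open>Suc\<close> matters: one step earlier y may still be 0, which leaves
    x unchanged.\<close>
  define N where "N = Suc (nat (snd (s 0)))"
  have y_neg: "snd (s (N + k)) \<le> - 1" for k
    unfolding y_eq[of "N + k"] by (simp add: N_def)
  have x_le: "fst (s (N + k)) \<le> fst (s N) - int k" for k
  proof (induction k)
    case (Suc k)
    then show ?case
      using x_Suc[of "N + k"] y_neg[of k] by simp
  qed simp
  \<comment> \<open>As x is positive at \<open>N\<close>, \<open>nat\<close> is exact there, and
    that many further steps force x down to 0 or below.\<close>
  show False
    using x_le[of "nat (fst (s N))"] pos[of "N + nat (fst (s N))"] pos[of N] by simp
qed

theorem theorem11p1:
  shows "terminating countdown_program"
  unfolding terminating_def
proof (intro allI impI)
  fix c
  assume c: "is_computation countdown_program c"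
  show "\<exists>ss. c = Finite_Seq ss"
  proof (cases c)
    case (Infinite_Seq s)
    with c show ?thesis
      using no_infinite_countdown[of s] by simp
  qed simp
qed

end
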